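(* Let $\mathcal{G} = \langle G;\diamond\rangle$ be a groupoid, let $T\subseteq G$ with $|T|\ge 2$, and suppose the following three conditions hold. 1. (Left Separation) If $\{x,y\}\subseteq T$ with $x\neq y$, then there is a yieldable set $L_{x,y}\subseteq G$ such that $s\diamond x\neq s'\diamond y$ and $\{s\diamond x, s'\diamond y\}\subseteq T$ for every $\langle s,s'\rangle\in L_{x,y}\times L_{x,y}$. 2. (Right Separation) If $\{x,y\}\subseteq T$ with $x\neq y$, then there is a yieldable set $R_{x,y}\subseteq G$ such that $x\diamond s\neq y\diamond s'$ and $\{x\diamond s, y\diamond s'\}\subseteq T$ for every $\langle s,s'\rangle\in R_{x,y}\times R_{x,y}$. 3. (Split Separation) For all $\{i,j\}\subseteq\mathbf{N}$ with $i\neq j$, there exist nonempty disjoint subsets $A$ and $B$ of $T$ and some $\vec g\in G^\omega$ which yields $A$ on the set of all $i$-splits and which yields $B$ on the set of all $j$-splits. Then $\mathcal{G}$ is completely dissociative.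
   Context: A groupoid $\langle G;\diamond\rangle$ is a set $G$ with a binary operation $\diamond$ on $G$. $\mathbf{N}=\{1,2,3,\ldots\}$, $\omega=\{0,1,2,\ldots\}$, and $G^\omega$ is the set of infinite sequences $\vec g=g_0g_1g_2\ldots$ of elements of $G$. Formal products. For $k\in\mathbf{N}$, $F^\sigma(k)$ is the set of formal $k$-products: the finite words $\mathbf{u}$ over the alphabet $\{\bullet,x_0,x_1,x_2,\ldots\}$ such that (1) $x_0x_1\ldots x_{k-1}$ is a subsequence of $\mathbf{u}$; (2) $\mathbf{u}$ has length $2k-1$; (3) $\bullet$ occurs exactly $k-1$ times in $\mathbf{u}$; (4) in every nonempty prefix of $\mathbf{u}$ the number of occurrences of $\bullet$ is strictly less than the number of other letters. These are exactly the reverse Polish forms of the full parenthesizations of $x_0x_1\ldots x_{k-1}$ (each variable once, in this order). $F^\sigma=\bigcup_{k\in\mathbf{N}}F^\sigma(k)$. For $\mathbf{u}\in F^\sigma(k)$ and $\vec g\in G^\omega$, $\vec g\,\mathbf{u}^\diamond\in G$ is the element obtained by replacing each $x_i$ in $\mathbf{u}$ by $g_i$ and each $\bullet$ by $\diamond$ and evaluating in reverse Polish notation ($ab\diamond$ means $a\diamond b$). Splits. Every $\mathbf{u}\in F^\sigma$ other than $x_0$ can be written uniquely as $\mathbf{u}=\mathbf{a}\mathbf{b}_i\bullet$ with $\mathbf{a}\in F^\sigma(i)$, $\mathbf{b}\in F^\sigma$, for some $i\in\mathbf{N}$, where $\mathbf{b}_i$ is obtained from $\mathbf{b}$ by replacing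 each $x_t$ with $x_{i+t}$; such a $\mathbf{u}$ is called an $i$-split. Yielding. For $U\subseteq F^\sigma$ and $S\subseteq G$, $\vec g\in G^\omega$ yields $S$ on $U$ iff $\vec g\,\mathbf{u}^\diamond\in S$ for all $\mathbf{u}\in U$; $\vec g$ yields $S$ iff it yields $S$ on $F^\sigma$. A set $S\subseteq G$ is yieldable iff some $\vec g\in G^\omega$ yields $S$. Dissociativity. $\langle G;\diamond\rangle$ is $k$-dissociative iff for every pair $\mathbf{u}\neq\mathbf{v}$ in $F^\sigma(k)$ there is $\vec g\in G^\omega$ with $\vec g\,\mathbf{u}^\diamond\neq\vec g\,\mathbf{v}^\diamond$. It is completely dissociative iff it is $k$-dissociative for every $k\ge 3$. *)

theory Defs
  imports Main "HOL-Library.Sublist" "HOL-Library.FuncSet"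
begin

definition groupoid :: "'a set \<Rightarrow> ('a \<Rightarrow> 'a \<Rightarrow> 'a) \<Rightarrow> bool" where
  "groupoid G d \<longleftrightarrow> d \<in> G \<rightarrow> G \<rightarrow> G"

definition seqs :: "'a set \<Rightarrow> (nat \<Rightarrow> 'a) set" where
  "seqs G = {g. \<forall>n. g n \<in> G}"

datatype letter = Bullet | Var nat

type_synonym word = "letter list"

definition formal_products_of :: "nat \<Rightarrow> word set" where
  "formal_products_of k = {u. k \<ge> 1
     \<and> subseq (map Var [0..<k]) u
     \<and> length u = 2 * k - 1
     \<and> count_list u Bullet = k - 1
     \<and> (\<forall>p. p \<noteq> [] \<and> prefix p u
          \<longrightarrow> count_list p Bullet < length (filter (\<lambda>c. c \<noteq> Bullet) p))}"

definition formal_products :: "word set" where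
  "formal_products = (\<Union>k\<in>{1..}. formal_products_of k)"

(* Reverse Polish evaluation with a stack whose head is its top element, so
   that the right operand lies above the left one.  The last clause (stack
   underflow) is never reached on a formal product. *)
fun rpn_run :: "('a \<Rightarrow> 'a \<Rightarrow> 'a) \<Rightarrow> (nat \<Rightarrow> 'a) \<Rightarrow> 'a list \<Rightarrow> word \<Rightarrow> 'a list" where
  "rpn_run d g st [] = st"
| "rpn_run d g st (Var i # w) = rpn_run d g (g i # st) w"
| "rpn_run d g (b # a # st) (Bullet # w) = rpn_run d g (d a b # st) w"
| "rpn_run d g st (Bullet # w) = rpn_run d g st w"

definition rpn_value :: "('a \<Rightarrow> 'a \<Rightarrow> 'a) \<Rightarrow> (nat \<Rightarrow> 'a) \<Rightarrow> word \<Rightarrow> 'a" where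
  "rpn_value d g u = hd (rpn_run d g [] u)"

primrec shift_letter :: "nat \<Rightarrow> letter \<Rightarrow> letter" where
  "shift_letter i Bullet = Bullet"
| "shift_letter i (Var t) = Var (i + t)"

definition shift_word :: "nat \<Rightarrow> word \<Rightarrow> word" where
  "shift_word i = map (shift_letter i)"

definition splits :: "nat \<Rightarrow> word set" where
  "splits i = {u \<in> formal_products. i \<ge> 1
     \<and> (\<exists>a \<in> formal_products_of i. \<exists>b \<in> formal_products. u = a @ shift_word i b @ [Bullet])}"

definition yields_on :: "('a \<Rightarrow> 'a \<Rightarrow> 'a) \<Rightarrow> (nat \<Rightarrow> 'a) \<Rightarrow> 'a set \<Rightarrow> word set \<Rightarrow> bool" where
  "yields_on d g S U \<longleftrightarrow> (\<forall>u\<in>U. rpn_value d g u \<in> S)"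

definition yieldable :: "'a set \<Rightarrow> ('a \<Rightarrow> 'a \<Rightarrow> 'a) \<Rightarrow> 'a set \<Rightarrow> bool" where
  "yieldable G d S \<longleftrightarrow> S \<subseteq> G \<and> (\<exists>g\<in>seqs G. yields_on d g S formal_products)"

definition dissociative :: "nat \<Rightarrow> 'a set \<Rightarrow> ('a \<Rightarrow> 'a \<Rightarrow> 'a) \<Rightarrow> bool" where
  "dissociative k G d \<longleftrightarrow>
     (\<forall>u\<in>formal_products_of k. \<forall>v\<in>formal_products_of k. u \<noteq> v
        \<longrightarrow> (\<exists>g\<in>seqs G. rpn_value d g u \<noteq> rpn_value d g v))"

definition completely_dissociative :: "'a set \<Rightarrow> ('a \<Rightarrow> 'a \<Rightarrow> 'a) \<Rightarrow> bool" where
  "completely_dissociative G d \<longleftrightarrow> (\<forall>k\<ge>3. dissociative k G d)"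

end

theory Submission
  imports Defs
begin

text \<open>
  A stronger claim is proved by induction on \<open>k\<close>: any two distinct formal \<open>k\<close>-products are
  separated by a sequence giving both of them values \<^emph>\<open>in\<close> \<open>T\<close>. The outermost operation of each
  product makes it an \<open>i\<close>-split and a \<open>j\<close>-split respectively. When \<open>i \<noteq> j\<close>, split separation finishes at
  once. When \<open>i = j\<close>, the products differ in their left or in their right factor. The induction
  hypothesis separates the factors on the side where they differ, with values \<open>x \<noteq> y\<close> in \<open>T\<close>; on
  the other side a sequence yielding \<open>L\<^bsub>x,y\<^esub>\<close> or \<open>R\<^bsub>x,y\<^esub>\<close> is used, so that whatever the factors there
  are, the two products again have distinct values in \<open>T\<close>. The two sequences can be
  chosen independently because the left factor only mentions variables below \<open>i\<close> and the right
  factor only the others, so they may be spliced at position \<open>i\<close>. Demanding values in \<open>T\<close> is what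
  lets the separation conditions be applied again one level higher.

  What remains is to connect words with products: the decomposition of a formal product at its
  outermost operation (lemma \<open>formal_product_split\<close>), and the fact that reverse Polish evaluation
  follows this decomposition (lemma \<open>rpn_value_split\<close>).
\<close>

section \<open>Balanced words\<close>

text \<open>
  Reading a word makes the stack grow by its excess; a balanced word thus never underflows and
  leaves exactly one entry. This isolates the part of the definition of a formal product that
  ignores the names of the variables, and which is therefore invariant under shifting.
\<close>

definition excess :: "word \<Rightarrow> int" where
  "excess w = int (length (filter (\<lambda>c. c \<noteq> Bullet) w)) - int (count_list w Bullet)"

definition balanced :: "word \<Rightarrow> bool" where
  "balanced w \<longleftrightarrow> excess w = 1 \<and> (\<forall>m. 0 < m \<and> m \<le> length w \<longrightarrow> excess (take m w) \<ge> 1)"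

lemma excess_simps [simp]:
  "excess [] = 0"
  "excess (Bullet # w) = excess w - 1"
  "excess (Var i # w) = excess w + 1"
  "excess (u @ v) = excess u + excess v"
  by (auto simp: excess_def)

lemma length_eq_filter_plus_count:
  "length w = length (filter (\<lambda>c. c \<noteq> Bullet) w) + count_list w Bullet"
  by (induction w) auto

text \<open>
  The last letter is \<open>Bullet\<close>, as reading a variable last would leave at least two entries. The left factor
  is the longest proper prefix of excess 1: every longer proper prefix then has excess at
  least 2, which is exactly the prefix condition for the right factor.
\<close>

lemma balanced_split:
  assumes "balanced w" and "length w \<ge> 2"
  obtains a b where "w = a @ b @ [Bullet]" "balanced a" "balanced b"
proof -
  obtain p c where w: "w = p @ [c]"
    using assms(2) by (cases w rule: rev_cases) auto
  have p: "length p \<ge> 1" using assms(2) w by simp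
  have prefixes: "excess (take m p) \<ge> 1" if "0 < m" "m \<le> length p" for m
    using assms(1) that unfolding balanced_def w by (auto dest!: spec[of _ m])
  have "excess p \<ge> 1" using prefixes[of "length p"] p by (simp add: Suc_le_eq)
  moreover have "excess p + excess [c] = 1" using assms(1) by (simp add: balanced_def w)
  ultimately have c: "c = Bullet" and excess_p: "excess p = 2"
    by (cases c; simp)+
  define M where "M = {m. 0 < m \<and> m \<le> length p \<and> excess (take m p) = 1}"
  have "finite M" unfolding M_def by simp
  moreover have "1 \<in> M"
  proof -
    obtain x q where "p = x # q" using p by (cases p) auto
    then show ?thesis using prefixes[of 1] by (cases x) (auto simp: M_def)
  qed
  ultimately have "Max M \<in> M" and maximal: "\<And>m. m \<in> M \<Longrightarrow> m \<le> Max M"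
    by (auto intro: Max_in)
  define n where "n = Max M"
  have n: "0 < n" "n \<le> length p" "excess (take n p) = 1"
    using \<open>Max M \<in> M\<close> by (auto simp: n_def M_def)
  have "balanced (take n p)"
    unfolding balanced_def using n prefixes by (auto simp: min_def)
  moreover have "balanced (drop n p)"
    unfolding balanced_def
  proof (intro conjI allI impI)
    have "excess (take n p) + excess (drop n p) = excess p"
      by (metis append_take_drop_id excess_simps(4))
    then show "excess (drop n p) = 1" using n excess_p by simp
  next
    fix m assume m: "0 < m \<and> m \<le> length (drop n p)"
    have le: "n + m \<le> length p" using m n(2) by auto
    have "take (n + m) p = take n p @ take m (drop n p)" by (rule take_add)
    then have "excess (take (n + m) p) = 1 + excess (take m (drop n p))" using n by simp
    moreover have "excess (take (n + m) p) \<noteq> 1"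
      using maximal[of "n + m"] m n le unfolding n_def[symmetric] by (auto simp: M_def)
    moreover have "excess (take (n + m) p) \<ge> 1" using prefixes[of "n + m"] m le by simp
    ultimately show "excess (take m (drop n p)) \<ge> 1" by simp
  qed
  ultimately show thesis using that[of "take n p" "drop n p"] w c by simp
qed

section \<open>Reverse Polish evaluation\<close>

lemma rpn_run_append: "rpn_run d g st (u @ v) = rpn_run d g (rpn_run d g st u) v"
  by (induction d g st u rule: rpn_run.induct) auto

lemma rpn_run_shift: "rpn_run d g st (shift_word i w) = rpn_run d (\<lambda>n. g (i + n)) st w"
  unfolding shift_word_def
  by (induction d "\<lambda>n. g (i + n)" st w rule: rpn_run.induct) auto

lemma rpn_run_cong:
  assumes "\<And>i. Var i \<in> set w \<Longrightarrow> g i = h i"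
  shows "rpn_run d g st w = rpn_run d h st w"
  using assms by (induction d g st w rule: rpn_run.induct) auto

lemma rpn_run_balanced:
  assumes "balanced w"
  shows "rpn_run d g st w = rpn_value d g w # st"
proof -
  \<comment> \<open>The pushed entry is the same for all initial stacks; starting from the empty one identifies
    it as the value.\<close>
  have "\<exists>x. \<forall>st. rpn_run d g st w = x # st"
    using assms
  proof (induction w rule: length_induct)
    case (1 w)
    show ?case
    proof (cases "length w \<ge> 2")
      case True
      then obtain a b where w: "w = a @ b @ [Bullet]" "balanced a" "balanced b"
        using "1.prems" balanced_split by blast
      then obtain x y where "\<forall>st. rpn_run d g st a = x # st" "\<forall>st. rpn_run d g st b = y # st"
        using "1.IH" by (metis append.assoc length_append_singleton length_append le_add1
            le_add2 le_imp_less_Suc)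
      then show ?thesis by (simp add: w rpn_run_append)
    next
      case False
      moreover have "w \<noteq> []" using "1.prems" by (auto simp: balanced_def)
      ultimately obtain c where "w = [c]" by (cases w; cases "tl w") auto
      with "1.prems" show ?thesis by (cases c) (auto simp: balanced_def)
    qed
  qed
  then show ?thesis by (auto simp: rpn_value_def)
qed

section \<open>Formal products and their outermost operation\<close>

lemma formal_products_of_iff:
  "u \<in> formal_products_of k \<longleftrightarrow>
     k \<ge> 1 \<and> filter (\<lambda>c. c \<noteq> Bullet) u = map Var [0..<k] \<and> balanced u" (is "?F \<longleftrightarrow> ?R")
proof
  assume F: ?F
  let ?vars = "filter (\<lambda>c. c \<noteq> Bullet) u"
  have k: "k \<ge> 1" and sub: "subseq (map Var [0..<k]) u" and len: "length u = 2 * k - 1"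
    and cnt: "count_list u Bullet = k - 1"
    and pre: "\<And>p. p \<noteq> [] \<Longrightarrow> prefix p u
          \<Longrightarrow> count_list p Bullet < length (filter (\<lambda>c. c \<noteq> Bullet) p)"
    using F by (auto simp: formal_products_of_def)
  have len_vars: "length ?vars = k"
    using length_eq_filter_plus_count[of u] k len cnt by simp
  have "subseq (filter (\<lambda>c. c \<noteq> Bullet) (map Var [0..<k])) ?vars"
    using sub by (rule subseq_filter)
  then have "subseq (map Var [0..<k]) ?vars" by (simp add: filter_map comp_def)
  then have "map Var [0..<k] = ?vars"
    using len_vars by (intro subseq_same_length) auto
  moreover have "balanced u"
    unfolding balanced_def
  proof (intro conjI allI impI)
    show "excess u = 1" using len_vars cnt k by (simp add: excess_def)
  next
    fix m assume "0 < m \<and> m \<le> length u"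
    then show "excess (take m u) \<ge> 1"
      using pre[of "take m u"] by (fastforce simp: excess_def take_is_prefix)
  qed
  ultimately show ?R using k by simp
next
  assume R: ?R
  then have k: "k \<ge> 1" and vars: "filter (\<lambda>c. c \<noteq> Bullet) u = map Var [0..<k]"
    and bal: "balanced u" by auto
  have cnt: "count_list u Bullet = k - 1"
    using bal vars k by (auto simp: balanced_def excess_def)
  have "subseq (map Var [0..<k]) u"
    using vars subseq_filter_left by metis
  moreover have "length u = 2 * k - 1"
    using length_eq_filter_plus_count[of u] vars cnt k by simp
  moreover have "count_list p Bullet < length (filter (\<lambda>c. c \<noteq> Bullet) p)"
    if "p \<noteq> []" "prefix p u" for p
  proof -
    have "take (length p) u = p" using that by (auto simp: prefix_def)
    then have "excess p \<ge> 1"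
      using bal that prefix_length_le[OF that(2)] unfolding balanced_def
      by (metis length_greater_0_conv)
    then show ?thesis by (simp add: excess_def)
  qed
  ultimately show ?F using k cnt by (auto simp: formal_products_of_def)
qed

lemma formal_products_of_subset: "formal_products_of k \<subseteq> formal_products"
  by (auto simp: formal_products_def formal_products_of_iff)

lemma formal_products_of_one: "u \<in> formal_products_of 1 \<Longrightarrow> u = [Var 0]"
proof -
  assume u: "u \<in> formal_products_of 1"
  then have "count_list u Bullet = 0" by (simp add: formal_products_of_def)
  then have "filter (\<lambda>c. c \<noteq> Bullet) u = u"
    by (auto simp: count_list_0_iff intro!: filter_True)
  then show ?thesis using u by (simp add: formal_products_of_iff)
qed

lemma Var_less:
  assumes "u \<in> formal_products_of k" and "Var t \<in> set u"
  shows "t < k"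
proof -
  have "Var t \<in> set (filter (\<lambda>c. c \<noteq> Bullet) u)" using assms(2) by simp
  also have "filter (\<lambda>c. c \<noteq> Bullet) u = map Var [0..<k]"
    using assms(1) by (simp add: formal_products_of_iff)
  finally show ?thesis by auto
qed

lemma filter_shift_word:
  "filter (\<lambda>c. c \<noteq> Bullet) (shift_word i w) = shift_word i (filter (\<lambda>c. c \<noteq> Bullet) w)"
proof -
  have "shift_letter i c \<noteq> Bullet \<longleftrightarrow> c \<noteq> Bullet" for c by (cases c) auto
  then show ?thesis by (simp add: shift_word_def filter_map comp_def)
qed

lemma inj_shift_word: "inj (shift_word i)"
proof -
  have "inj (shift_letter i)"
  proof (rule injI)
    fix x y show "shift_letter i x = shift_letter i y \<Longrightarrow> x = y" by (cases x; cases y) auto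
  qed
  then show ?thesis unfolding shift_word_def by (rule inj_mapI)
qed

lemma excess_shift_word [simp]: "excess (shift_word i w) = excess w"
proof (induction w)
  case (Cons c w)
  then show ?case by (cases c) (auto simp: shift_word_def)
qed (simp add: shift_word_def)

lemma balanced_shift_word [simp]: "balanced (shift_word i w) \<longleftrightarrow> balanced w"
proof -
  have "take m (shift_word i w) = shift_word i (take m w)" for m
    by (simp add: shift_word_def take_map)
  then show ?thesis by (simp add: balanced_def) (simp add: shift_word_def)
qed

lemma ex_unshift_word:
  assumes "\<And>t. Var t \<in> set w \<Longrightarrow> i \<le> t"
  obtains b where "w = shift_word i b"
proof -
  have "\<forall>c\<in>set w. \<exists>c'. c = shift_letter i c'"
  proof
    fix c assume c: "c \<in> set w"
    show "\<exists>c'. c = shift_letter i c'"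
    proof (cases c)
      case Bullet
      then show ?thesis by (intro exI[of _ Bullet]) simp
    next
      case (Var t)
      then show ?thesis using assms c by (intro exI[of _ "Var (t - i)"]) simp
    qed
  qed
  then have "w \<in> range (shift_word i)"
    unfolding shift_word_def by (induction w) (auto simp: image_iff intro: exI[of _ "_ # _"])
  then show thesis using that by auto
qed

text \<open>
  Since the variables occur in increasing order, cutting the underlying balanced word
  also cuts the list of variables into an initial segment and the rest; the length of the
  initial segment is the index of the split.
\<close>

lemma formal_product_split:
  assumes u: "u \<in> formal_products_of k" and k: "k \<ge> 2"
  obtains i a b where "1 \<le> i" "i < k" "a \<in> formal_products_of i" "b \<in> formal_products_of (k - i)"
    "u = a @ shift_word i b @ [Bullet]"
proof -
  let ?vars = "filter (\<lambda>c. c \<noteq> Bullet)"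
  have "length u \<ge> 2" using u k by (auto simp: formal_products_of_def)
  moreover have vars: "?vars u = map Var [0..<k]" and "balanced u"
    using u by (auto simp: formal_products_of_iff)
  ultimately obtain a w where w: "u = a @ w @ [Bullet]" "balanced a" "balanced w"
    using balanced_split by blast
  define i where "i = length (?vars a)"
  have app: "?vars a @ ?vars w = map Var [0..<k]" using vars w(1) by simp
  have "i \<ge> 1" "length (?vars w) \<ge> 1"
    using w(2,3) by (simp_all add: i_def balanced_def excess_def)
  moreover have "i + length (?vars w) = k"
    using arg_cong[OF app, of length] by (simp add: i_def)
  ultimately have i: "1 \<le> i" "i < k" by auto
  have vars_a: "?vars a = map Var [0..<i]"
    using arg_cong[OF app, of "take i"] i by (simp add: i_def take_map)
  have vars_w: "?vars w = map Var [i..<k]"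
    using arg_cong[OF app, of "drop i"] i by (simp add: i_def drop_map)
  have "i \<le> t" if "Var t \<in> set w" for t
  proof -
    have "Var t \<in> set (?vars w)" using that by simp
    then show ?thesis using vars_w by auto
  qed
  then obtain b where b: "w = shift_word i b" by (rule ex_unshift_word)
  have "[i..<k] = map (\<lambda>n. i + n) [0..<k - i]"
    using map_add_upt[of i "k - i"] i by (simp add: add.commute)
  then have "shift_word i (?vars b) = shift_word i (map Var [0..<k - i])"
    using vars_w by (simp add: b filter_shift_word) (simp add: shift_word_def)
  then have "?vars b = map Var [0..<k - i]" using inj_shift_word by (metis injD)
  then have "b \<in> formal_products_of (k - i)"
    using i w(3) by (simp add: formal_products_of_iff b)
  moreover have "a \<in> formal_products_of i"
    using i w(2) vars_a by (simp add: formal_products_of_iff)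
  ultimately show thesis using that i w(1) b by blast
qed

definition splice_at :: "nat \<Rightarrow> (nat \<Rightarrow> 'a) \<Rightarrow> (nat \<Rightarrow> 'a) \<Rightarrow> nat \<Rightarrow> 'a" where
  "splice_at i g h n = (if n < i then g n else h (n - i))"

lemma splice_at_in_seqs: "g \<in> seqs G \<Longrightarrow> h \<in> seqs G \<Longrightarrow> splice_at i g h \<in> seqs G"
  by (auto simp: seqs_def splice_at_def)

lemma rpn_value_split:
  assumes a: "a \<in> formal_products_of i" and b: "b \<in> formal_products_of j"
  shows "rpn_value d (splice_at i g h) (a @ shift_word i b @ [Bullet])
    = d (rpn_value d g a) (rpn_value d h b)"
proof -
  have "rpn_run d (splice_at i g h) st a = rpn_run d g st a" for st
    using Var_less[OF a] by (intro rpn_run_cong) (auto simp: splice_at_def)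
  moreover have "(\<lambda>n. splice_at i g h (i + n)) = h" by (auto simp: splice_at_def)
  ultimately show ?thesis
    using a b
    by (simp add: formal_products_of_iff rpn_value_def[of _ _ "_ @ _"] rpn_run_append
        rpn_run_shift rpn_run_balanced)
qed

section \<open>Complete dissociativity\<close>

theorem theorem3p2:
  fixes G T :: "'a set"
    and d :: "'a \<Rightarrow> 'a \<Rightarrow> 'a" (infixl "\<diamondop>" 70)
  assumes "groupoid G d"
    and "T \<subseteq> G"
    and "infinite T \<or> card T \<ge> 2"
    and left_separation:
      "\<And>x y. x \<in> T \<Longrightarrow> y \<in> T \<Longrightarrow> x \<noteq> y \<Longrightarrow>
         \<exists>L. yieldable G d L
           \<and> (\<forall>s\<in>L. \<forall>s'\<in>L. s \<diamondop> x \<noteq> s' \<diamondop> y \<and> s \<diamondop> x \<in> T \<and> s' \<diamondop> y \<in> T)"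
    and right_separation:
      "\<And>x y. x \<in> T \<Longrightarrow> y \<in> T \<Longrightarrow> x \<noteq> y \<Longrightarrow>
         \<exists>R. yieldable G d R
           \<and> (\<forall>s\<in>R. \<forall>s'\<in>R. x \<diamondop> s \<noteq> y \<diamondop> s' \<and> x \<diamondop> s \<in> T \<and> y \<diamondop> s' \<in> T)"
    and split_separation:
      "\<And>i j. i \<ge> 1 \<Longrightarrow> j \<ge> 1 \<Longrightarrow> i \<noteq> j \<Longrightarrow>
         \<exists>A B. A \<noteq> {} \<and> B \<noteq> {} \<and> A \<subseteq> T \<and> B \<subseteq> T \<and> A \<inter> B = {}
           \<and> (\<exists>g\<in>seqs G. yields_on d g A (splits i) \<and> yields_on d g B (splits j))"
  shows "completely_dissociative G d"
proof -
  have separated: "\<exists>g\<in>seqs G. rpn_value d g u \<noteq> rpn_value d g v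
      \<and> rpn_value d g u \<in> T \<and> rpn_value d g v \<in> T"
    if "u \<in> formal_products_of k" "v \<in> formal_products_of k" "u \<noteq> v" for k u v
    using that
  proof (induction k arbitrary: u v rule: less_induct)
    case (less k)
    have "k \<noteq> 1" using less.prems formal_products_of_one by metis
    then have k: "k \<ge> 2" using less.prems(1) by (simp add: formal_products_of_iff)
    obtain i a b where u: "1 \<le> i" "i < k" "a \<in> formal_products_of i"
      "b \<in> formal_products_of (k - i)" "u = a @ shift_word i b @ [Bullet]"
      using formal_product_split[OF less.prems(1) k] .
    obtain j a' b' where v: "1 \<le> j" "j < k" "a' \<in> formal_products_of j"
      "b' \<in> formal_products_of (k - j)" "v = a' @ shift_word j b' @ [Bullet]"
      using formal_product_split[OF less.prems(2) k] .
    note in_products = subsetD[OF formal_products_of_subset]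
    show ?case
    proof (cases "i = j")
      case False
      have "u \<in> splits i"
        using u(1,3,5) in_products[OF less.prems(1)] in_products[OF u(4)]
        unfolding splits_def by blast
      moreover have "v \<in> splits j"
        using v(1,3,5) in_products[OF less.prems(2)] in_products[OF v(4)]
        unfolding splits_def by blast
      moreover obtain A B g where "A \<subseteq> T" "B \<subseteq> T" "A \<inter> B = {}" "g \<in> seqs G"
        "yields_on d g A (splits i)" "yields_on d g B (splits j)"
        using split_separation[OF u(1) v(1) False] by (elim exE conjE bexE)
      ultimately have "rpn_value d g u \<in> A" "rpn_value d g v \<in> B"
        by (auto simp: yields_on_def)
      with \<open>A \<inter> B = {}\<close> \<open>A \<subseteq> T\<close> \<open>B \<subseteq> T\<close> \<open>g \<in> seqs G\<close> show ?thesis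
        by (intro bexI[of _ g]) auto
    next
      case True
      note v = v[folded True]
      have value_u: "rpn_value d (splice_at i g h) u = rpn_value d g a \<diamondop> rpn_value d h b"
        and value_v: "rpn_value d (splice_at i g h) v = rpn_value d g a' \<diamondop> rpn_value d h b'" for g h
        unfolding u(5) v(5) by (rule rpn_value_split u v)+
      show ?thesis
      proof (cases "a = a'")
        case True
        then have "b \<noteq> b'" using less.prems(3) u(5) v(5) by auto
        then obtain h where h: "h \<in> seqs G" "rpn_value d h b \<noteq> rpn_value d h b'"
          "rpn_value d h b \<in> T" "rpn_value d h b' \<in> T"
          using less.IH[OF _ u(4) v(4)] u(1,2) by auto
        then obtain L where "yieldable G d L" and L: "\<forall>s\<in>L. \<forall>s'\<in>L.
            s \<diamondop> rpn_value d h b \<noteq> s' \<diamondop> rpn_value d h b'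
            \<and> s \<diamondop> rpn_value d h b \<in> T \<and> s' \<diamondop> rpn_value d h b' \<in> T"
          using left_separation[OF h(3,4,2)] by blast
        then obtain g where "g \<in> seqs G" "yields_on d g L formal_products"
          by (auto simp: yieldable_def)
        then show ?thesis
          using L h(1) in_products[OF u(3)] in_products[OF v(3)]
          by (intro bexI[of _ "splice_at i g h"])
            (auto simp: value_u value_v yields_on_def splice_at_in_seqs)
      next
        case False
        then obtain g where g: "g \<in> seqs G" "rpn_value d g a \<noteq> rpn_value d g a'"
          "rpn_value d g a \<in> T" "rpn_value d g a' \<in> T"
          using less.IH[OF u(2,3) v(3)] by auto
        then obtain R where "yieldable G d R" and R: "\<forall>s\<in>R. \<forall>s'\<in>R.
            rpn_value d g a \<diamondop> s \<noteq> rpn_value d g a' \<diamondop> s'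
            \<and> rpn_value d g a \<diamondop> s \<in> T \<and> rpn_value d g a' \<diamondop> s' \<in> T"
          using right_separation[OF g(3,4,2)] by blast
        then obtain h where "h \<in> seqs G" "yields_on d h R formal_products"
          by (auto simp: yieldable_def)
        then show ?thesis
          using R g(1) in_products[OF u(4)] in_products[OF v(4)]
          by (intro bexI[of _ "splice_at i g h"])
            (auto simp: value_u value_v yields_on_def splice_at_in_seqs)
      qed
    qed
  qed
  then show ?thesis unfolding completely_dissociative_def dissociative_def by blast
qed

end
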